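(* There exist $v\in W^{1,1}(0,1)$ and a continuous Lagrangian $L\colon[0,1]\times\mathbb{R}\times\mathbb{R}\to[0,\infty)$, $L=L(t,y,p)$, convex in $p$, such that $v$ is a minimizer of $\mathscr{L}$ over $\mathscr{A}_{v(0),v(1)}$ and $0\le\mathscr{L}(v)<\infty$, but $\mathscr{L}(v+u)=\infty$ for all non-zero $u\in W^{1,\infty}_0(0,1)$. Moreover, the Lavrentiev phenomenon occurs.
   Context: $\mathscr{L}(u)=\int_0^1L(t,u(t),u'(t))\,dt\in[0,\infty]$ for $u\in W^{1,1}(0,1)$ (real-valued functions, identified with their absolutely continuous representatives on $[0,1]$). $\mathscr{A}_{A,B}=\{u\in W^{1,1}(0,1):u(0)=A,\ u(1)=B\}$. A minimizer of $\mathscr{L}$ over $\mathscr{A}_{A,B}$ is $v\in\mathscr{A}_{A,B}$ with $\mathscr{L}(v)\le\mathscr{L}(u)$ for all $u\in\mathscr{A}_{A,B}$. $W_0^{1,\infty}(0,1)$ is the space of Lipschitz functions on $[0,1]$ vanishing at $0$ and $1$. For a minimizer $v$ of $\mathscr{L}$ over $\mathscr{A}_{v(0),v(1)}$, the Lavrentiev phenomenon is said to occur if there is no sequence $u_j\in W^{1,\infty}(0,1)\cap\mathscr{A}_{v(0),v(1)}$ with $\mathscr{L}(u_j)\to\mathscr{L}(v)$, i.e. $\inf\{\mathscr{L}(u):u\in W^{1,\infty}(0,1)\cap\mathscr{A}_{v(0),v(1)}\}>\mathscr{L}(v)$. *)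

theory Defs
  imports "HOL-Analysis.Analysis"
begin

definition abs_continuous_on :: "real set \<Rightarrow> (real \<Rightarrow> real) \<Rightarrow> bool" where
  "abs_continuous_on S u \<longleftrightarrow>
     (\<forall>\<epsilon>>0. \<exists>\<delta>>0. \<forall>I :: (real \<times> real) set.
        finite I \<longrightarrow>
        (\<forall>(a, b)\<in>I. a \<le> b \<and> {a..b} \<subseteq> S) \<longrightarrow>
        disjoint_family_on (\<lambda>(a, b). {a<..<b}) I \<longrightarrow>
        (\<Sum>(a, b)\<in>I. b - a) < \<delta> \<longrightarrow>
        (\<Sum>(a, b)\<in>I. \<bar>u b - u a\<bar>) < \<epsilon>)"

text \<open>
  Elements of \<open>W\<^sup>1\<^sup>,\<^sup>1(0,1)\<close> are represented by their absolutely continuous representatives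
  on \<open>[0,1]\<close>, and those of \<open>W\<^sup>1\<^sup>,\<^sup>\<infinity>(0,1)\<close> by their Lipschitz representatives. The values
  of a function outside \<open>[0,1]\<close> are irrelevant throughout.
\<close>

definition W11 :: "(real \<Rightarrow> real) set" where
  "W11 = {u. abs_continuous_on {0..1} u}"

definition W1inf :: "(real \<Rightarrow> real) set" where
  "W1inf = {u. \<exists>C. C-lipschitz_on {0..1} u}"

definition W1inf0 :: "(real \<Rightarrow> real) set" where
  "W1inf0 = {u \<in> W1inf. u 0 = 0 \<and> u 1 = 0}"

definition admissible :: "real \<Rightarrow> real \<Rightarrow> (real \<Rightarrow> real) set" where
  "admissible A B = {u \<in> W11. u 0 = A \<and> u 1 = B}"

definition lagrangian :: "(real \<Rightarrow> real \<Rightarrow> real \<Rightarrow> real) \<Rightarrow> bool" where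
  "lagrangian L \<longleftrightarrow>
     continuous_on ({0..1} \<times> UNIV \<times> UNIV) (\<lambda>(t, y, p). L t y p) \<and>
     (\<forall>t\<in>{0..1}. \<forall>y p. 0 \<le> L t y p) \<and>
     (\<forall>t\<in>{0..1}. \<forall>y. convex_on UNIV (\<lambda>p. L t y p))"

text \<open>
  An absolutely continuous \<open>u\<close> is differentiable almost everywhere on \<open>[0,1]\<close>, with classical
  derivative equal almost everywhere to its weak derivative. The arbitrary value of
  \<^const>\<open>deriv\<close> on the remaining null set (in particular at the endpoints) does not affect
  the integral.
\<close>

definition energy :: "(real \<Rightarrow> real \<Rightarrow> real \<Rightarrow> real) \<Rightarrow> (real \<Rightarrow> real) \<Rightarrow> ennreal" where
  "energy L u = (\<integral>\<^sup>+t\<in>{0..1}. ennreal (L t (u t) (deriv u t)) \<partial>lborel)"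

definition is_minimizer ::
  "(real \<Rightarrow> real \<Rightarrow> real \<Rightarrow> real) \<Rightarrow> real \<Rightarrow> real \<Rightarrow> (real \<Rightarrow> real) \<Rightarrow> bool" where
  "is_minimizer L A B v \<longleftrightarrow>
     v \<in> admissible A B \<and> (\<forall>u\<in>admissible A B. energy L v \<le> energy L u)"

definition lavrentiev :: "(real \<Rightarrow> real \<Rightarrow> real \<Rightarrow> real) \<Rightarrow> (real \<Rightarrow> real) \<Rightarrow> bool" where
  "lavrentiev L v \<longleftrightarrow>
     \<not> (\<exists>w :: nat \<Rightarrow> real \<Rightarrow> real.
           (\<forall>j. w j \<in> W1inf \<inter> admissible (v 0) (v 1)) \<and>
           (\<lambda>j. energy L (w j)) \<longlonglongrightarrow> energy L v)"

lemma lavrentiev_iff_INF: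
  assumes "is_minimizer L (v 0) (v 1) v" and fin: "energy L v < \<infinity>"
  shows "lavrentiev L v \<longleftrightarrow>
    energy L v < (INF u \<in> W1inf \<inter> admissible (v 0) (v 1). energy L u)" (is "_ \<longleftrightarrow> _ < ?m")
proof -
  let ?S = "W1inf \<inter> admissible (v 0) (v 1)"
  have le: "energy L v \<le> energy L u" if "u \<in> ?S" for u
    using assms that unfolding is_minimizer_def by blast
  show ?thesis
  proof
    assume lav: "lavrentiev L v"
    show "energy L v < ?m"
    proof (rule ccontr)
      assume "\<not> energy L v < ?m"
      moreover have "energy L v \<le> ?m" by (rule INF_greatest) (rule le)
      ultimately have eq: "?m = energy L v" by (simp add: not_less antisym)
      have "\<exists>u\<in>?S. energy L u < energy L v + ennreal (1 / real (Suc j))" for j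
      proof -
        have "?m < energy L v + ennreal (1 / real (Suc j))"
          unfolding eq using fin
          by (cases "energy L v" rule: ennreal_cases)
             (simp_all add: ennreal_plus[symmetric] ennreal_less_iff del: ennreal_plus)
        then show ?thesis by (simp add: INF_less_iff)
      qed
      then obtain w where w: "\<And>j. w j \<in> ?S"
          "\<And>j. energy L (w j) < energy L v + ennreal (1 / real (Suc j))"
        by metis
      have "(\<lambda>j. energy L v + ennreal (1 / real (Suc j))) \<longlonglongrightarrow> energy L v + ennreal 0"
        by (rule tendsto_add[OF tendsto_const tendsto_ennrealI])
          (rule LIMSEQ_inverse_real_of_nat[unfolded inverse_eq_divide])
      then have up: "(\<lambda>j. energy L v + ennreal (1 / real (Suc j))) \<longlonglongrightarrow> energy L v"
        by simp
      have "(\<lambda>j. energy L (w j)) \<longlonglongrightarrow> energy L v"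
        by (rule tendsto_sandwich[OF _ _ tendsto_const up])
           (rule always_eventually, rule allI, rule le, rule w(1),
            rule always_eventually, rule allI, rule less_imp_le, rule w(2))
      with lav w(1) show False unfolding lavrentiev_def by blast
    qed
  next
    assume less: "energy L v < ?m"
    show "lavrentiev L v"
      unfolding lavrentiev_def
    proof (intro notI, elim exE conjE)
      fix w :: "nat \<Rightarrow> real \<Rightarrow> real"
      assume "\<forall>j. w j \<in> ?S" and lim: "(\<lambda>j. energy L (w j)) \<longlonglongrightarrow> energy L v"
      then have "?m \<le> energy L (w j)" for j by (blast intro: INF_lower)
      then have "?m \<le> energy L v" by (intro LIMSEQ_le_const[OF lim] exI allI impI)
      with less show False by simp
    qed
  qed
qed

end

theory Submission
  imports Defs
begin

text \<open>
  The Lagrangian is \<open>L t y p = (y - v t)\<^sup>2 * p\<^sup>2\<close>. It vanishes on the graph of \<open>v\<close>, so \<open>v\<close> has energy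
  \<open>0\<close> and is a minimizer whatever \<open>v\<close> is. It is continuous as soon as \<open>v\<close> is, and convex in \<open>p\<close>. The
  whole difficulty is the choice of \<open>v\<close>, which must have two properties.

  First, the derivative of \<open>v\<close> is integrable, but its square is not integrable on any interval.
  If \<open>u\<close> is Lipschitz and \<open>u t \<noteq> 0\<close> for some \<open>t\<close>, then on an interval around \<open>t\<close> the integrand of
  \<open>v + u\<close> is at least a positive constant times \<open>(v' + u')\<^sup>2\<close> with \<open>u'\<close> bounded, so the energy is
  infinite (\<open>energy_infinite_of_lipschitz_perturbation\<close>).

  Secondly, \<open>v 0 = 0\<close> and \<open>v t \<ge> t powr (1/4)\<close>. A Lipschitz function \<open>w\<close> with the same boundary
  values starts below \<open>v / 2\<close> and must climb to \<open>v / 2\<close> at some first time \<open>b\<close>. Until then it pays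
  at least \<open>t powr (1/2) * w'\<^sup>2 / 4\<close> at time \<open>t\<close>, and the exponents are balanced so that the total
  price has a positive lower bound for all \<open>b\<close> (\<open>energy_lower_bound\<close>). This is the Lavrentiev gap.

  Both properties hold for the primitive of a geometrically weighted sum of translates of
  \<open>s powr (-3/4)\<close>, with one singularity at \<open>0\<close> and one at each rational number
  (\<open>function_with_nowhere_square_integrable_derivative\<close>).

  Since the energy refers to the pointwise derivative, both estimates rest on the fact that a
  Lipschitz function is differentiable almost everywhere and is the integral of its derivative.
  It is derived from the Radon-Nikodym theorem and Lebesgue's differentiation theorem
  (\<open>lipschitz_on_unit_interval_density\<close>).
\<close>

section \<open>Lipschitz functions are integrals of their derivatives\<close>

text \<open>
  Lebesgue's differentiation theorem on the line. \<open>integrable_ccontinuous_explicit\<close> controls the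
  averages of \<open>f\<close> over \<open>[x, x + h]\<close>, which is the right derivative of \<open>F\<close>; the left derivative
  comes from applying the same statement to the reflected pair \<open>- F (- x)\<close>, \<open>f (- x)\<close>.
\<close>

lemma has_real_derivative_indefinite_integral_AE:
  fixes f F :: "real \<Rightarrow> real"
  assumes int: "\<And>a b. a \<le> b \<Longrightarrow> (f has_integral (F b - F a)) {a..b}"
  shows "AE x in lborel. (F has_real_derivative f x) (at x)"
proof -
  have one_sided: "\<exists>N. negligible N \<and> (\<forall>x. x \<notin> N \<longrightarrow> (H has_real_derivative g x) (at_right x))"
    if H: "\<And>a b. a \<le> b \<Longrightarrow> (g has_integral (H b - H a)) {a..b}" for g H :: "real \<Rightarrow> real"
  proof -
    have "g integrable_on cbox a b" for a b
      using H[of a b] by (cases "a \<le> b") (auto simp: integrable_on_def)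
    then obtain N where N: "negligible N"
      and lim: "\<And>x e. x \<notin> N \<Longrightarrow> 0 < e \<Longrightarrow> \<exists>d>0. \<forall>h. 0 < h \<and> h < d \<longrightarrow>
        norm (integral (cbox x (x + h *\<^sub>R One)) g /\<^sub>R h ^ DIM(real) - g x) < e"
      using integrable_ccontinuous_explicit[of g] by metis
    have "(H has_real_derivative g x) (at_right x)" if "x \<notin> N" for x
      unfolding has_field_derivative_iff tendsto_iff
    proof (intro allI impI)
      fix e :: real assume "0 < e"
      from lim[OF that this] obtain d where d: "d > 0" "\<And>h. 0 < h \<Longrightarrow> h < d \<Longrightarrow>
        norm (integral {x..x + h} g / h - g x) < e"
        by (auto simp: divide_inverse mult.commute)
      show "\<forall>\<^sub>F y in at_right x. dist ((H y - H x) / (y - x)) (g x) < e"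
        unfolding eventually_at_right_field
      proof (intro exI[of _ "x + d"] conjI allI impI)
        fix y assume y: "x < y" "y < x + d"
        have "integral {x..x + (y - x)} g = H y - H x"
          using integral_unique[OF H[of x y]] y by simp
        with d(2)[of "y - x"] y show "dist ((H y - H x) / (y - x)) (g x) < e"
          by (simp add: dist_norm)
      qed (use d in simp)
    qed
    with N show ?thesis by blast
  qed
  obtain N where N: "negligible N"
    and right: "\<And>x. x \<notin> N \<Longrightarrow> (F has_real_derivative f x) (at_right x)"
    using one_sided[OF int] by blast
  have "((\<lambda>x. f (- x)) has_integral ((\<lambda>x. - F (- x)) b - (\<lambda>x. - F (- x)) a)) {a..b}"
    if "a \<le> b" for a b
    using has_integral_reflect_lemma_real[OF int[of "- b" "- a"]] that by simp
  from one_sided[OF this] obtain N' where N': "negligible N'"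
    and left': "\<And>x. x \<notin> N' \<Longrightarrow> ((\<lambda>x. - F (- x)) has_real_derivative f (- x)) (at_right x)"
    by blast
  have left: "(F has_real_derivative f x) (at_left x)" if "- x \<notin> N'" for x
  proof -
    have "((\<lambda>y. (- F (- y) - - F (- (- x))) / (y - - x)) \<longlongrightarrow> f (- (- x))) (at_right (- x))"
      using left'[OF that] unfolding has_field_derivative_iff .
    moreover have "(- F (- y) - - F (- (- x))) / (y - - x) = (F (- y) - F x) / (- y - x)" for y
      by (metis (no_types, opaque_lifting) add.commute add_uminus_conv_diff minus_diff_eq
          minus_divide_divide minus_minus)
    ultimately show ?thesis
      unfolding has_field_derivative_iff filterlim_at_left_to_right by simp
  qed
  have "negligible (N \<union> uminus ` N')"
  proof (intro negligible_Un N negligible_locally_Lipschitz_image[OF _ N'])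
    show "\<exists>T B. open T \<and> x \<in> T \<and> (\<forall>y\<in>N' \<inter> T. norm (- y - - x) \<le> B * norm (y - x))" for x
      by (intro exI[of _ UNIV] exI[of _ 1]) auto
  qed simp
  then have "AE x in lebesgue. x \<notin> N \<union> uminus ` N'"
    unfolding negligible_iff_null_sets by (rule AE_not_in)
  then have "AE x in lebesgue. (F has_real_derivative f x) (at x)"
  proof eventually_elim
    case (elim x)
    then have "- x \<notin> N'" by (metis UnCI image_eqI minus_minus)
    with elim right left show ?case
      by (simp add: has_field_derivative_iff filterlim_at_split)
  qed
  then show ?thesis by (simp add: AE_completion_iff)
qed

text \<open>
  Adding a steep linear function to \<open>w\<close> gives an increasing bijection \<open>F\<close> of the line that is
  still Lipschitz. The measure \<open>A \<mapsto> \<lambda>(F ` A)\<close>, realised as the push-forward of Lebesgue measure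
  under the inverse of \<open>F\<close>, is the Stieltjes measure of \<open>F\<close>, and it vanishes on null sets because
  Lipschitz images of null sets are null. Its Radon-Nikodym density is the derivative of \<open>F\<close> in
  integrated form.
\<close>

lemma lipschitz_indefinite_integral:
  fixes w :: "real \<Rightarrow> real"
  assumes lip: "C-lipschitz_on UNIV w"
  obtains f where "\<And>a b. a \<le> b \<Longrightarrow> set_integrable lborel {a..b} f"
    and "\<And>a b. a \<le> b \<Longrightarrow> (LINT x:{a..b}|lborel. f x) = w b - w a"
proof -
  have C: "C \<ge> 0" and wC: "\<bar>w x - w y\<bar> \<le> C * \<bar>x - y\<bar>" for x y
    using lip by (auto simp: lipschitz_on_def dist_real_def)
  define F where "F x = w x + (C + 1) * x" for x
  have F_grow: "y - x \<le> F y - F x" if "x \<le> y" for x y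
    using wC[of x y] that unfolding F_def by (simp add: algebra_simps abs_if split: if_splits)
  have F_lip: "\<bar>F x - F y\<bar> \<le> (2 * C + 1) * \<bar>x - y\<bar>" for x y
  proof -
    have "\<bar>F x - F y\<bar> \<le> \<bar>w x - w y\<bar> + \<bar>(C + 1) * (x - y)\<bar>"
      unfolding F_def by (simp add: algebra_simps)
    also have "\<dots> \<le> C * \<bar>x - y\<bar> + (C + 1) * \<bar>x - y\<bar>"
      using wC[of x y] C by (simp add: abs_mult)
    finally show ?thesis by (simp add: algebra_simps)
  qed
  have "strict_mono F"
    by (rule strict_monoI) (use F_grow in \<open>force simp: less_le\<close>)
  then have inj: "inj F" and F_le: "F x \<le> F y \<longleftrightarrow> x \<le> y" for x y
    by (auto simp: strict_mono_less_eq strict_mono_imp_inj_on)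
  have "continuous_on UNIV w" using lip by (rule lipschitz_on_continuous_on)
  then have cont: "continuous_on UNIV F" unfolding F_def by (intro continuous_intros)
  have surj: "\<exists>x. F x = y" for y
  proof -
    define r where "r = \<bar>y\<bar> + \<bar>F 0\<bar>"
    have "r \<ge> 0" by (simp add: r_def)
    with F_grow[of "- r" 0] F_grow[of 0 r] have "F (- r) \<le> y" "y \<le> F r" "- r \<le> r"
      unfolding r_def by linarith+
    then show ?thesis
      using IVT'[of F "- r" y r] continuous_on_subset[OF cont] by blast
  qed
  define G where "G = inv F"
  have GF: "G (F x) = x" for x unfolding G_def using inj by simp
  have FG: "F (G y) = y" for y unfolding G_def using surj by (metis surj_f_inv_f surj_def)
  have "mono G"
  proof (rule monoI)
    fix x y :: real assume "x \<le> y"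
    then show "G x \<le> G y" using F_le[of "G x" "G y"] by (simp only: FG)
  qed
  then have [measurable]: "G \<in> borel_measurable borel" by (rule borel_measurable_mono)
  define M where "M = distr lborel borel G"
  have M_Icc: "emeasure M {a..b} = ennreal (F b - F a)" if "a \<le> b" for a b
  proof -
    have "a \<le> G y \<longleftrightarrow> F a \<le> y" "G y \<le> b \<longleftrightarrow> y \<le> F b" for y
      using F_le[of a "G y"] F_le[of "G y" b] FG[of y] by simp_all
    then have "G -` {a..b} = {F a..F b}" by auto
    then show ?thesis using that F_le by (simp add: M_def emeasure_distr)
  qed
  have "absolutely_continuous lborel M"
    unfolding absolutely_continuous_def
  proof
    fix N :: "real set" assume N: "N \<in> null_sets lborel"
    then have "negligible N" by (simp add: negligible_iff_null_sets null_sets_completionI)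
    have GN_eq: "G -` N = F ` N"
    proof (intro equalityI subsetI)
      fix y assume "y \<in> G -` N"
      then have "F (G y) \<in> F ` N" by blast
      then show "y \<in> F ` N" by (simp only: FG)
    qed (auto simp: GF)
    have "negligible (F ` N)"
    proof (rule negligible_locally_Lipschitz_image[OF _ \<open>negligible N\<close>])
      fix x assume "x \<in> N"
      show "\<exists>T B. open T \<and> x \<in> T \<and> (\<forall>y\<in>N \<inter> T. norm (F y - F x) \<le> B * norm (y - x))"
        using F_lip by (intro exI[of _ UNIV] exI[of _ "2 * C + 1"]) auto
    qed simp
    then have null: "emeasure lebesgue (G -` N) = 0"
      unfolding GN_eq negligible_iff_null_sets by (rule null_setsD1)
    have NB: "N \<in> sets borel" using null_setsD2[OF N] by simp
    have "G -` N \<in> sets borel"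
      by (rule measurable_sets_borel[OF \<open>G \<in> borel_measurable borel\<close> NB])
    then have "emeasure lborel (G -` N) = 0"
      using null emeasure_completion[of "G -` N" lborel] unfolding sets_lborel by simp
    then have "emeasure M N = 0"
      unfolding M_def using NB by (simp add: emeasure_distr)
    then show "N \<in> null_sets M"
      using NB by (intro null_setsI) (simp_all add: M_def)
  qed
  then have "\<exists>g\<in>borel_measurable lborel. density lborel g = M"
    by (rule sigma_finite_measure.Radon_Nikodym[OF sigma_finite_lborel]) (simp add: M_def)
  then obtain g where [measurable]: "g \<in> borel_measurable lborel"
    and g: "density lborel g = M" by blast
  have nn_g: "(\<integral>\<^sup>+x. g x * indicator {a..b} x \<partial>lborel) = ennreal (F b - F a)" if "a \<le> b" for a b
    using M_Icc[OF that] emeasure_density[of g lborel "{a..b}"] by (simp add: g)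
  \<comment> \<open>The density is locally integrable, hence finite almost everywhere on each \<open>[-n, n]\<close>.\<close>
  have fin: "AE x in lborel. g x < \<infinity>"
  proof -
    have "AE x in lborel. \<forall>n::nat. g x * indicator {- real n..real n} x \<noteq> \<infinity>"
      unfolding AE_all_countable by (intro allI nn_integral_PInf_AE) (auto simp: nn_g)
    then show ?thesis
    proof eventually_elim
      case (elim x)
      obtain n where "\<bar>x\<bar> \<le> real n" using real_arch_simple by blast
      then have "indicator {- real n..real n} x = (1 :: ennreal)" by (simp add: abs_le_iff)
      with elim[rule_format, of n] show ?case by (simp add: less_top)
    qed
  qed
  define f where "f x = enn2real (g x) - (C + 1)" for x
  have hb: "has_bochner_integral lborel (\<lambda>x. indicator {a..b} x *\<^sub>R enn2real (g x)) (F b - F a)"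
    if "a \<le> b" for a b
  proof (rule has_bochner_integral_nn_integral)
    have "(\<integral>\<^sup>+x. ennreal (indicator {a..b} x *\<^sub>R enn2real (g x)) \<partial>lborel)
        = (\<integral>\<^sup>+x. g x * indicator {a..b} x \<partial>lborel)"
      using fin by (intro nn_integral_cong_AE) (auto simp: indicator_def)
    with nn_g[OF that] show "(\<integral>\<^sup>+x. ennreal (indicator {a..b} x *\<^sub>R enn2real (g x)) \<partial>lborel)
      = ennreal (F b - F a)" by simp
  qed (use F_le that in auto)
  have hf: "has_bochner_integral lborel (\<lambda>x. indicator {a..b} x *\<^sub>R f x) (w b - w a)"
    if "a \<le> b" for a b
  proof -
    have "has_bochner_integral lborel (indicat_real {a..b}) (b - a)"
      using has_bochner_integral_real_indicator[of "{a..b}" lborel] that by simp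
    then have "has_bochner_integral lborel (\<lambda>x. indicat_real {a..b} x * (C + 1)) ((b - a) * (C + 1))"
      by (intro has_bochner_integral_mult_left)
    from has_bochner_integral_diff[OF hb[OF that] this] show ?thesis
      by (simp add: f_def F_def algebra_simps)
  qed
  then show ?thesis
    by (intro that[of f]) (auto simp: set_integrable_def set_lebesgue_integral_def
        has_bochner_integral_iff)
qed

text \<open>
  Rademacher's theorem and the fundamental theorem of calculus on the unit interval. Every
  energy estimate for a Lipschitz competitor goes through this lemma, since nothing is known
  about the value of \<^const>\<open>deriv\<close> at points of non-differentiability.
\<close>

lemma lipschitz_on_unit_interval_density:
  fixes u :: "real \<Rightarrow> real"
  assumes lip: "C-lipschitz_on {0..1} u"
  obtains f where "\<And>b. b \<in> {0..1} \<Longrightarrow> set_integrable lborel {0..b} f"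
    and "\<And>b. b \<in> {0..1} \<Longrightarrow> (LINT t:{0..b}|lborel. f t) = u b - u 0"
    and "AE t in lborel. t \<in> {0<..<1} \<longrightarrow> (u has_real_derivative f t) (at t) \<and> \<bar>f t\<bar> \<le> C"
proof -
  \<comment> \<open>Extend \<open>u\<close> to the line by its end values, which keeps the Lipschitz constant.\<close>
  define w where "w t = u (max 0 (min 1 t))" for t
  have w_eq: "w t = u t" if "t \<in> {0..1}" for t using that by (simp add: w_def)
  have C: "0 \<le> C" using lip by (rule lipschitz_on_nonneg)
  have lip_w: "C-lipschitz_on UNIV w"
  proof (rule lipschitz_onI[OF _ C])
    fix x y :: real
    have "dist (w x) (w y) \<le> C * dist (max 0 (min 1 x)) (max 0 (min 1 y))"
      unfolding w_def by (rule lipschitz_onD[OF lip]) auto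
    also have "\<dots> \<le> C * dist x y"
      by (rule mult_left_mono[OF _ C]) (auto simp: dist_real_def)
    finally show "dist (w x) (w y) \<le> C * dist x y" .
  qed
  obtain f where f: "\<And>a b. a \<le> b \<Longrightarrow> set_integrable lborel {a..b} f"
    "\<And>a b. a \<le> b \<Longrightarrow> (LINT x:{a..b}|lborel. f x) = w b - w a"
    using lipschitz_indefinite_integral[OF lip_w] by metis
  have "(f has_integral (w b - w a)) {a..b}" if "a \<le> b" for a b
    using set_borel_integral_eq_integral[OF f(1)[OF that]] f(2)[OF that]
    by (metis has_integral_integral)
  then have "AE t in lborel. (w has_real_derivative f t) (at t)"
    by (rule has_real_derivative_indefinite_integral_AE)
  then have "AE t in lborel. t \<in> {0<..<1} \<longrightarrow> (u has_real_derivative f t) (at t) \<and> \<bar>f t\<bar> \<le> C"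
  proof eventually_elim
    case (elim t)
    have "(u has_real_derivative f t) (at t)" if t: "t \<in> {0<..<1}"
    proof (rule has_field_derivative_transform_within_open[OF elim _ t])
      show "w x = u x" if "x \<in> {0<..<1}" for x using w_eq that by simp
    qed simp
    moreover have "\<bar>f t\<bar> \<le> C"
    proof (rule tendsto_upperbound)
      show "((\<lambda>y. \<bar>(w y - w t) / (y - t)\<bar>) \<longlongrightarrow> \<bar>f t\<bar>) (at t)"
        using elim unfolding has_field_derivative_iff by (rule tendsto_rabs)
      have "\<bar>(w y - w t) / (y - t)\<bar> \<le> C" if "y \<noteq> t" for y
        using lipschitz_onD[OF lip_w, of y t] that by (simp add: dist_real_def abs_divide divide_le_eq)
      then show "\<forall>\<^sub>F y in at t. \<bar>(w y - w t) / (y - t)\<bar> \<le> C"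
        by (auto simp: eventually_at_filter)
    qed simp
    ultimately show ?case by blast
  qed
  with f show ?thesis by (intro that[of f]) (auto simp: w_eq)
qed

section \<open>Absolute continuity\<close>

text \<open>
  Split \<open>f\<close> at a height \<open>n\<close>: the excess \<open>g n\<close> above \<open>n\<close> has small total integral, and the bounded
  part contributes at most \<open>n\<close> times the total length of the intervals.
\<close>

lemma abs_continuous_on_indefinite_integral:
  fixes f F :: "real \<Rightarrow> real"
  assumes int: "integrable lborel f" and nonneg: "\<And>x. 0 \<le> f x"
    and F: "\<And>a b. a \<le> b \<Longrightarrow> F b - F a = (LINT x:{a..b}|lborel. f x)"
  shows "abs_continuous_on S F"
  unfolding abs_continuous_on_def
proof (intro allI impI)
  fix e :: real assume e: "0 < e"
  have [measurable]: "f \<in> borel_measurable borel" using int by auto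
  define g where "g = (\<lambda>(n :: nat) x. f x - min (f x) (real n))"
  have [measurable]: "g n \<in> borel_measurable borel" for n unfolding g_def by measurable
  have g: "0 \<le> g n x" "f x \<le> real n + g n x" for n x by (auto simp: g_def)
  have int_g: "integrable lborel (g n)" for n
    by (rule Bochner_Integration.integrable_bound[OF int]) (use nonneg in \<open>auto simp: g_def min_def\<close>)
  have "(\<lambda>n. LINT x|lborel. g n x) \<longlonglongrightarrow> integral\<^sup>L lborel (\<lambda>x :: real. 0)"
  proof (rule integral_dominated_convergence[where w = f])
    show "AE x in lborel. (\<lambda>n. g n x) \<longlonglongrightarrow> 0"
    proof (rule AE_I2)
      fix x :: real
      obtain N where N: "f x \<le> real N" using real_arch_simple by blast
      have "\<forall>\<^sub>F n in sequentially. g n x = 0"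
        using eventually_ge_at_top[of N] by eventually_elim (use N in \<open>auto simp: g_def min_def\<close>)
      then show "(\<lambda>n. g n x) \<longlonglongrightarrow> 0" by (rule tendsto_eventually)
    qed
    show "AE x in lborel. norm (g n x) \<le> f x" for n
      using nonneg by (intro AE_I2) (simp add: g_def min_def)
  qed (use int in simp_all)
  then have "\<forall>\<^sub>F n in sequentially. (LINT x|lborel. g n x) < e / 2"
    by (rule order_tendstoD(2)) (use e in simp)
  then obtain n where n: "(LINT x|lborel. g n x) < e / 2" by (auto simp: eventually_sequentially)
  show "\<exists>d>0. \<forall>I. finite I \<longrightarrow> (\<forall>(a, b)\<in>I. a \<le> b \<and> {a..b} \<subseteq> S) \<longrightarrow>
      disjoint_family_on (\<lambda>(a, b). {a<..<b}) I \<longrightarrow> (\<Sum>(a, b)\<in>I. b - a) < d \<longrightarrow>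
      (\<Sum>(a, b)\<in>I. \<bar>F b - F a\<bar>) < e"
  proof (intro exI[of _ "e / (2 * (real n + 1))"] conjI allI impI)
    fix I :: "(real \<times> real) set"
    assume fin: "finite I" and I: "\<forall>(a, b)\<in>I. a \<le> b \<and> {a..b} \<subseteq> S"
      and disj: "disjoint_family_on (\<lambda>(a, b). {a<..<b}) I"
      and small: "(\<Sum>(a, b)\<in>I. b - a) < e / (2 * (real n + 1))"
    define J where "J = (\<lambda>i :: real \<times> real. {fst i<..<snd i})"
    have int_J: "integrable lborel (\<lambda>x. indicator (J i) x *\<^sub>R g n x)" for i
      using int_g by (intro integrable_mult_indicator) (auto simp: J_def)
    have *: "\<bar>F b - F a\<bar> \<le> real n * (b - a) + (LINT x|lborel. indicator (J (a, b)) x *\<^sub>R g n x)"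
      if "(a, b) \<in> I" for a b
    proof -
      have ab: "a \<le> b" using I that by auto
      have "F b - F a = (LINT x|lborel. indicator {a..b} x *\<^sub>R f x)"
        using F[OF ab] by (simp add: set_lebesgue_integral_def)
      also have "\<dots> = (LINT x|lborel. indicator {a<..<b} x *\<^sub>R f x)"
      proof (rule integral_cong_AE)
        have "AE x in lborel. x \<noteq> a" "AE x in lborel. x \<noteq> b" by (simp_all add: AE_lborel_singleton)
        then show "AE x in lborel. indicat_real {a..b} x *\<^sub>R f x = indicat_real {a<..<b} x *\<^sub>R f x"
          by eventually_elim (auto simp: indicator_def)
      qed auto
      also have "\<dots> \<le> (LINT x|lborel. real n * indicator {a<..<b} x + indicator {a<..<b} x *\<^sub>R g n x)"
      proof (rule integral_mono)
        show "integrable lborel (\<lambda>x. indicator {a<..<b} x *\<^sub>R f x)"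
          using int by (intro integrable_mult_indicator) auto
        show "integrable lborel (\<lambda>x. real n * indicator {a<..<b} x + indicator {a<..<b} x *\<^sub>R g n x)"
          using int_J[of "(a, b)"] ab by (intro Bochner_Integration.integrable_add) (auto simp: J_def)
      qed (use g(2) in \<open>auto simp: indicator_def\<close>)
      also have "\<dots> = real n * (b - a) + (LINT x|lborel. indicator (J (a, b)) x *\<^sub>R g n x)"
        using int_J[of "(a, b)"] ab by (subst Bochner_Integration.integral_add) (auto simp: J_def)
      finally have "F b - F a \<le> \<dots>" .
      moreover have "0 \<le> F b - F a"
        unfolding F[OF ab] set_lebesgue_integral_def using nonneg by (intro Bochner_Integration.integral_nonneg) auto
      ultimately show ?thesis by simp
    qed
    have "(\<Sum>(a, b)\<in>I. \<bar>F b - F a\<bar>)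
        \<le> (\<Sum>(a, b)\<in>I. real n * (b - a) + (LINT x|lborel. indicator (J (a, b)) x *\<^sub>R g n x))"
      by (rule sum_mono) (use * in auto)
    also have "\<dots> = real n * (\<Sum>(a, b)\<in>I. b - a) + (\<Sum>i\<in>I. (LINT x|lborel. indicator (J i) x *\<^sub>R g n x))"
      by (simp add: case_prod_unfold sum.distrib sum_distrib_left)
    also have "(\<Sum>i\<in>I. (LINT x|lborel. indicator (J i) x *\<^sub>R g n x))
        = (LINT x|lborel. (\<Sum>i\<in>I. indicator (J i) x *\<^sub>R g n x))"
      by (rule Bochner_Integration.integral_sum[symmetric]) (rule int_J)
    also have "\<dots> \<le> (LINT x|lborel. g n x)"
    proof (rule integral_mono)
      show "integrable lborel (\<lambda>x. \<Sum>i\<in>I. indicator (J i) x *\<^sub>R g n x)"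
        by (rule Bochner_Integration.integrable_sum) (rule int_J)
      fix x
      have "disjoint_family_on J I" using disj by (simp add: J_def case_prod_unfold)
      then have "(\<Sum>i\<in>I. indicat_real (J i) x) = indicat_real (\<Union>i\<in>I. J i) x"
        by (rule indicator_UN_disjoint[OF fin, symmetric])
      then have "(\<Sum>i\<in>I. indicator (J i) x *\<^sub>R g n x) = indicat_real (\<Union>i\<in>I. J i) x * g n x"
        by (simp flip: sum_distrib_right)
      also have "\<dots> \<le> 1 * g n x"
        by (rule mult_right_mono) (auto simp: g(1) indicator_def)
      finally show "(\<Sum>i\<in>I. indicator (J i) x *\<^sub>R g n x) \<le> g n x" by simp
    qed (rule int_g)
    also have "real n * (\<Sum>(a, b)\<in>I. b - a) \<le> e / 2"
    proof -
      have "(real n + 1) * (\<Sum>(a, b)\<in>I. b - a) < e / 2"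
        using small by (simp add: field_simps)
      moreover have "0 \<le> (\<Sum>(a, b)\<in>I. b - a)"
        by (rule sum_nonneg) (use I in auto)
      ultimately show ?thesis by (simp add: algebra_simps)
    qed
    finally show "(\<Sum>(a, b)\<in>I. \<bar>F b - F a\<bar>) < e" using n by simp
  qed (use e in simp)
qed

lemma abs_continuous_on_imp_continuous_on:
  assumes ac: "abs_continuous_on {a..b} u"
  shows "continuous_on {a..b} u"
  unfolding continuous_on_iff
proof (intro ballI allI impI)
  fix x e :: real assume x: "x \<in> {a..b}" and "0 < e"
  obtain d where d: "d > 0"
    and small: "\<forall>I. finite I \<longrightarrow> (\<forall>(s, t)\<in>I. s \<le> t \<and> {s..t} \<subseteq> {a..b}) \<longrightarrow>
        disjoint_family_on (\<lambda>(s, t). {s<..<t}) I \<longrightarrow>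
        (\<Sum>(s, t)\<in>I. t - s) < d \<longrightarrow> (\<Sum>(s, t)\<in>I. \<bar>u t - u s\<bar>) < e"
    using ac \<open>0 < e\<close> unfolding abs_continuous_on_def by blast
  have "\<bar>u t - u s\<bar> < e" if "s \<le> t" "t - s < d" "s \<in> {a..b}" "t \<in> {a..b}" for s t
    using small[rule_format, of "{(s, t)}"] that by (auto simp: disjoint_family_on_def)
  note close = this
  show "\<exists>d>0. \<forall>y\<in>{a..b}. dist y x < d \<longrightarrow> dist (u y) (u x) < e"
  proof (intro exI[of _ d] conjI ballI impI d)
    fix y assume y: "y \<in> {a..b}" "dist y x < d"
    show "dist (u y) (u x) < e"
    proof (cases "x \<le> y")
      case True
      with close[of x y] x y show ?thesis by (simp add: dist_real_def)
    next
      case False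
      with close[of y x] x y show ?thesis by (simp add: dist_real_def)
    qed
  qed
qed

section \<open>A function whose derivative is nowhere locally square integrable\<close>

lemma has_bochner_integral_powr_from_0:
  fixes a b :: real
  assumes "a > -1" "b \<ge> 0"
  shows "has_bochner_integral lborel (\<lambda>t. indicator {0..b} t * t powr a) (b powr (a + 1) / (a + 1))"
proof (rule has_bochner_integral_nn_integral)
  have "(\<integral>\<^sup>+t. ennreal (indicator {0..b} t * t powr a) \<partial>lborel)
      = (\<integral>\<^sup>+t. ennreal (t powr a) * indicator {0..b} t \<partial>lborel)"
    by (intro nn_integral_cong) (auto simp: indicator_def)
  also have "\<dots> = ennreal (b powr (a + 1) / (a + 1))"
    by (rule nn_integral_has_integral_lebesgue'[OF _ has_integral_powr_from_0[OF assms]]) simp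
  finally show "(\<integral>\<^sup>+t. ennreal (indicator {0..b} t * t powr a) \<partial>lborel)
      = ennreal (b powr (a + 1) / (a + 1))" .
qed (use assms in auto)

text \<open>
  The exponent \<open>-3/4\<close> is integrable at \<open>0\<close> while its square is not, and the factor \<open>1/4\<close> makes the
  primitive equal to \<open>s powr (1/4)\<close>. It is also the right growth for the lower energy bound: the
  integral of \<open>v\<^sup>2 * w'\<^sup>2\<close> with \<open>v\<close> growing like \<open>t powr a\<close> scales like \<open>t powr (4 * a - 1)\<close>, so an
  exponent \<open>a\<close> of at most \<open>1/4\<close> keeps it from being small on short intervals.
\<close>

definition spike :: "real \<Rightarrow> real" where
  "spike s = indicator {0..1} s * s powr (-3/4) / 4"

lemma spike_nonneg: "0 \<le> spike s"
  by (simp add: spike_def)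

lemma measurable_spike [measurable]: "spike \<in> borel_measurable borel"
  unfolding spike_def by measurable

lemma nn_integral_spike: "(\<integral>\<^sup>+s. ennreal (spike (s - q)) \<partial>lborel) = 1"
proof -
  have "has_bochner_integral lborel spike 1"
    using has_bochner_integral_divide_zero[OF has_bochner_integral_powr_from_0[of "-3/4" 1], of 4]
    by (simp add: spike_def[abs_def])
  then have "(\<integral>\<^sup>+s. ennreal (spike s) \<partial>lborel) = 1"
    using nn_integral_eq_integral[of lborel spike]
    by (simp add: has_bochner_integral_iff spike_nonneg)
  then show ?thesis
    using nn_integral_real_affine[of "\<lambda>s. ennreal (spike s)" 1 "- q"] by simp
qed

text \<open>
  Superposing countably many translated spikes with geometric weights gives an integrable
  density that dominates a multiple of each of them.
\<close>

lemma spike_series: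
  fixes q :: "nat \<Rightarrow> real"
  obtains \<rho> :: "real \<Rightarrow> real" where "integrable lborel \<rho>" "\<And>t. 0 \<le> \<rho> t"
    "\<And>n. AE t in lborel. (1/2)^n * spike (t - q n) \<le> \<rho> t"
proof -
  define R :: "real \<Rightarrow> ennreal" where "R = (\<lambda>t. \<Sum>n. ennreal ((1/2)^n * spike (t - q n)))"
  have [measurable]: "R \<in> borel_measurable borel" unfolding R_def by measurable
  have "(\<integral>\<^sup>+t. R t \<partial>lborel) = (\<Sum>n. \<integral>\<^sup>+t. ennreal ((1/2)^n * spike (t - q n)) \<partial>lborel)"
    unfolding R_def by (rule nn_integral_suminf) measurable
  also have "\<dots> = (\<Sum>n. ennreal ((1/2)^n))"
    by (simp add: ennreal_mult' nn_integral_cmult nn_integral_spike spike_nonneg)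
  also have "\<dots> = ennreal (\<Sum>n. (1/2)^n)"
    by (rule suminf_ennreal2) (simp_all add: summable_geometric)
  finally have R_int: "(\<integral>\<^sup>+t. R t \<partial>lborel) < \<infinity>" by simp
  then have fin: "AE t in lborel. R t \<noteq> \<infinity>"
    by (intro nn_integral_PInf_AE) auto
  show ?thesis
  proof (rule that[of "\<lambda>t. enn2real (R t)"])
    have "(\<integral>\<^sup>+t. ennreal (enn2real (R t)) \<partial>lborel) = (\<integral>\<^sup>+t. R t \<partial>lborel)"
      using fin by (intro nn_integral_cong_AE) (auto simp: less_top)
    with R_int show "integrable lborel (\<lambda>t. enn2real (R t))"
      by (intro integrableI_bounded) auto
    show "AE t in lborel. (1/2)^n * spike (t - q n) \<le> enn2real (R t)" for n
      using fin
    proof eventually_elim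
      case (elim t)
      have "sum (\<lambda>n. ennreal ((1/2)^n * spike (t - q n))) {n} \<le> R t"
        unfolding R_def by (rule sum_le_suminf) auto
      then have "enn2real (ennreal ((1/2)^n * spike (t - q n))) \<le> enn2real (R t)"
        using elim by (intro enn2real_mono) (auto simp: less_top)
      then show ?case by (simp add: spike_nonneg)
    qed
  qed simp
qed

text \<open>
  \<open>v\<close> is the primitive of a series of spikes whose centres are \<open>0\<close> and all rationals. The spike at
  \<open>0\<close> has weight \<open>1\<close> and gives \<open>t powr (1/4) \<le> v t\<close>; the other ones put a singularity of order
  \<open>-3/4\<close> of the derivative \<open>\<rho>\<close> into every interval.
\<close>

lemma function_with_nowhere_square_integrable_derivative:
  obtains v \<rho> :: "real \<Rightarrow> real" where "\<And>S. abs_continuous_on S v" "v 0 = 0"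
    "\<And>t. t \<in> {0..1} \<Longrightarrow> t powr (1/4) \<le> v t"
    "AE t in lborel. (v has_real_derivative \<rho> t) (at t)"
    "\<And>a b. a < b \<Longrightarrow> \<exists>q c. a < q \<and> q < b \<and> 0 < c \<and>
       (AE t in lborel. t \<in> {q<..<q + 1} \<longrightarrow> c * (t - q) powr (-3/4) \<le> \<rho> t)"
proof -
  define q :: "nat \<Rightarrow> real" where "q n = (case n of 0 \<Rightarrow> 0 | Suc m \<Rightarrow> from_nat_into \<rat> m)" for n
  obtain \<rho> :: "real \<Rightarrow> real" where int: "integrable lborel \<rho>" and nonneg: "\<And>t. 0 \<le> \<rho> t"
    and \<rho>: "\<And>n. AE t in lborel. (1/2)^n * spike (t - q n) \<le> \<rho> t"
    using spike_series[of q] by metis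
  define v where "v t = (LINT s:{..t}|lborel. \<rho> s) - (LINT s:{..0}|lborel. \<rho> s)" for t
  have int_on: "set_integrable lborel A \<rho>" if "A \<in> sets borel" for A
    unfolding set_integrable_def using int that by (intro integrable_mult_indicator) auto
  have v_diff: "v b - v a = (LINT s:{a..b}|lborel. \<rho> s)" if "a \<le> b" for a b
  proof -
    have "v b - v a = (LINT s|lborel. indicator {..b} s *\<^sub>R \<rho> s - indicator {..a} s *\<^sub>R \<rho> s)"
      using int_on[of "{..a}"] int_on[of "{..b}"]
      by (subst Bochner_Integration.integral_diff)
         (auto simp: v_def set_lebesgue_integral_def set_integrable_def)
    also have "\<dots> = (LINT s:{a..b}|lborel. \<rho> s)"
      unfolding set_lebesgue_integral_def
    proof (rule integral_cong_AE)
      have "AE s in lborel. s \<noteq> a" by (simp add: AE_lborel_singleton)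
      then show "AE s in lborel. indicator {..b} s *\<^sub>R \<rho> s - indicator {..a} s *\<^sub>R \<rho> s
          = indicat_real {a..b} s *\<^sub>R \<rho> s"
        by eventually_elim (use that in \<open>auto simp: indicator_def\<close>)
    qed (use int in auto)
    finally show ?thesis .
  qed
  show ?thesis
  proof (rule that[of v \<rho>])
    show "abs_continuous_on S v" for S
      using int nonneg v_diff by (rule abs_continuous_on_indefinite_integral)
    show v0: "v 0 = 0" by (simp add: v_def)
    show "AE t in lborel. (v has_real_derivative \<rho> t) (at t)"
    proof (rule has_real_derivative_indefinite_integral_AE)
      fix a b :: real assume "a \<le> b"
      with set_borel_integral_eq_integral[OF int_on, of "{a..b}"] v_diff
      show "(\<rho> has_integral (v b - v a)) {a..b}" by (simp add: has_integral_integral)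
    qed
    show "t powr (1/4) \<le> v t" if t: "t \<in> {0..1}" for t
    proof -
      have hb: "has_bochner_integral lborel (\<lambda>s. indicator {0..t} s * s powr (-3/4) / 4)
          (t powr (1/4))"
        using has_bochner_integral_divide_zero[OF has_bochner_integral_powr_from_0[of "-3/4" t], of 4]
          t by simp
      have "t powr (1/4) = (LINT s|lborel. indicator {0..t} s * s powr (-3/4) / 4)"
        using hb by (simp add: has_bochner_integral_iff)
      also have "\<dots> \<le> (LINT s|lborel. indicator {0..t} s *\<^sub>R \<rho> s)"
      proof (rule integral_mono_AE)
        show "AE s in lborel. indicator {0..t} s * s powr (-3/4) / 4 \<le> indicator {0..t} s *\<^sub>R \<rho> s"
          using \<rho>[of 0]
        proof eventually_elim
          case (elim s)
          then show ?case using t by (auto simp: q_def spike_def indicator_def)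
        qed
      qed (use hb int_on[of "{0..t}"] in \<open>auto simp: has_bochner_integral_iff set_integrable_def\<close>)
      also have "\<dots> = v t"
        using v_diff[of 0 t] t v0 by (simp add: set_lebesgue_integral_def)
      finally show ?thesis .
    qed
    show "\<exists>p c. a < p \<and> p < b \<and> 0 < c \<and>
       (AE t in lborel. t \<in> {p<..<p + 1} \<longrightarrow> c * (t - p) powr (-3/4) \<le> \<rho> t)" if ab: "a < b" for a b
    proof -
      obtain p where p: "p \<in> \<rat>" "a < p" "p < b" using Rats_dense_in_real[OF ab] by blast
      obtain m where "from_nat_into \<rat> m = p"
        using from_nat_into_surj[OF countable_rat p(1)] by blast
      then have qm: "q (Suc m) = p" by (simp add: q_def)
      have "AE t in lborel. t \<in> {p<..<p + 1} \<longrightarrow> (1/2)^(Suc m) / 4 * (t - p) powr (-3/4) \<le> \<rho> t"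
        using \<rho>[of "Suc m"] unfolding qm
        by eventually_elim (auto simp: spike_def indicator_def)
      then show ?thesis
        using p(2,3) zero_less_divide_iff[of "(1/2 :: real)^(Suc m)" 4]
        by (intro exI[of _ p] exI[of _ "(1/2)^(Suc m) / 4"] conjI) (assumption | simp)+
    qed
  qed
qed

text \<open>
  On \<open>(q, q + e)\<close> the integrand is at least its value \<open>c * e powr (-3/2)\<close> at the right end, so the
  integral is at least \<open>c / sqrt e\<close> for every small \<open>e\<close>.
\<close>

lemma nn_integral_inverse_powr_infinite:
  fixes f :: "real \<Rightarrow> ennreal"
  assumes c: "0 < c" and d: "0 < d"
    and f: "AE t in lborel. t \<in> {q<..<q + d} \<longrightarrow> ennreal (c * (t - q) powr (-3/2)) \<le> f t"
  shows "(\<integral>\<^sup>+t. f t \<partial>lborel) = \<infinity>"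
proof (rule ccontr)
  assume "(\<integral>\<^sup>+t. f t \<partial>lborel) \<noteq> \<infinity>"
  then obtain r where r: "0 \<le> r" "(\<integral>\<^sup>+t. f t \<partial>lborel) = ennreal r"
    by (metis ennreal_cases infinity_ennreal_def)
  define e where "e = min d ((c / (r + 1))\<^sup>2)"
  have e: "0 < e" "e \<le> d" using c d r by (auto simp: e_def)
  have "sqrt e \<le> sqrt ((c / (r + 1))\<^sup>2)"
    by (rule real_sqrt_le_mono) (simp add: e_def)
  then have "sqrt e \<le> c / (r + 1)" using c r by simp
  then have large: "r + 1 \<le> c / sqrt e" using e r by (simp add: field_simps)
  have "e powr (-3/2) * e = e powr (- (1/2))"
    using powr_add[of e "-3/2" 1] e by simp
  also have "\<dots> = 1 / sqrt e"
    unfolding powr_minus_divide using e by (simp add: powr_half_sqrt)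
  finally have eq: "c * e powr (-3/2) * e = c / sqrt e"
    by (simp add: mult.assoc)
  have "ennreal (c / sqrt e) = ennreal (c * e powr (-3/2)) * ennreal e"
    unfolding eq[symmetric] using c e(1) by (intro ennreal_mult) auto
  also have "\<dots> = (\<integral>\<^sup>+t. ennreal (c * e powr (-3/2)) * indicator {q<..<q + e} t \<partial>lborel)"
    using e(1) by (subst nn_integral_cmult_indicator) simp_all
  also have "\<dots> \<le> (\<integral>\<^sup>+t. f t \<partial>lborel)"
  proof (rule nn_integral_mono_AE)
    show "AE t in lborel. ennreal (c * e powr (-3/2)) * indicator {q<..<q + e} t \<le> f t"
      using f
    proof eventually_elim
      case (elim t)
      show ?case
      proof (cases "t \<in> {q<..<q + e}")
        case True
        then have "e powr (-3/2) \<le> (t - q) powr (-3/2)"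
          by (intro powr_mono2') auto
        with c have "ennreal (c * e powr (-3/2)) \<le> ennreal (c * (t - q) powr (-3/2))"
          by (intro ennreal_leI mult_left_mono) auto
        with elim True e show ?thesis by (auto intro: order_trans)
      qed simp
    qed
  qed
  finally have "c / sqrt e \<le> r" using r by simp
  with large show False by simp
qed

section \<open>The Lagrangian\<close>

definition contact_lagrangian :: "(real \<Rightarrow> real) \<Rightarrow> real \<Rightarrow> real \<Rightarrow> real \<Rightarrow> real" where
  "contact_lagrangian v t y p = (y - v t)\<^sup>2 * p\<^sup>2"

lemma convex_on_square: "convex_on UNIV (\<lambda>p :: real. p\<^sup>2)"
  by (rule f''_ge0_imp_convex[where f' = "\<lambda>p. 2 * p" and f'' = "\<lambda>_. 2"])
     (auto intro!: derivative_eq_intros)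

lemma lagrangian_contact_lagrangian:
  assumes "continuous_on {0..1} v"
  shows "lagrangian (contact_lagrangian v)"
  unfolding lagrangian_def
proof (intro conjI ballI allI)
  have "continuous_on ({0..1} \<times> UNIV \<times> UNIV) (\<lambda>x :: real \<times> real \<times> real. v (fst x))"
    by (rule continuous_on_compose2[OF assms]) (auto intro!: continuous_intros)
  then show "continuous_on ({0..1} \<times> UNIV \<times> UNIV) (\<lambda>(t, y, p). contact_lagrangian v t y p)"
    unfolding contact_lagrangian_def case_prod_unfold by (intro continuous_intros)
  show "convex_on UNIV (contact_lagrangian v t y)" for t y
    unfolding contact_lagrangian_def[abs_def] by (rule convex_on_cmul[OF _ convex_on_square]) simp
qed (simp add: contact_lagrangian_def)

lemma energy_contact_lagrangian_self: "energy (contact_lagrangian v) v = 0"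
  by (simp add: energy_def contact_lagrangian_def)

section \<open>Lipschitz perturbations have infinite energy\<close>

text \<open>
  Near a point where \<open>u\<close> does not vanish, the factor \<open>u\<^sup>2\<close> of the integrand is bounded below.
  There is a singularity \<open>q\<close> of \<open>\<rho>\<close> nearby, and close to \<open>q\<close> it exceeds twice the bound \<open>C\<close> of \<open>u'\<close>;
  so \<open>u'\<close> can cancel at most half of \<open>\<rho>\<close>, and \<open>(\<rho> + u')\<^sup>2\<close> is not integrable.
\<close>

lemma energy_infinite_of_lipschitz_perturbation:
  fixes u v \<rho> :: "real \<Rightarrow> real"
  assumes v_deriv: "AE t in lborel. (v has_real_derivative \<rho> t) (at t)"
    and rough: "\<And>a b. a < b \<Longrightarrow> \<exists>q c. a < q \<and> q < b \<and> 0 < c \<and>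
       (AE t in lborel. t \<in> {q<..<q + 1} \<longrightarrow> c * (t - q) powr (-3/4) \<le> \<rho> t)"
    and u: "u \<in> W1inf0" and nz: "t\<^sub>0 \<in> {0..1}" "u t\<^sub>0 \<noteq> 0"
  shows "energy (contact_lagrangian v) (\<lambda>t. v t + u t) = \<infinity>"
proof -
  obtain C where lip: "C-lipschitz_on {0..1} u" and bd: "u 0 = 0" "u 1 = 0"
    using u by (auto simp: W1inf0_def W1inf_def)
  have C: "0 \<le> C" using lip by (rule lipschitz_on_nonneg)
  have t0: "0 < t\<^sub>0" "t\<^sub>0 < 1" using nz bd by (auto simp: less_le)
  define \<eta> where "\<eta> = \<bar>u t\<^sub>0\<bar> / 2"
  have \<eta>: "0 < \<eta>" using nz by (simp add: \<eta>_def)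
  define b where "b = min 1 (t\<^sub>0 + \<eta> / (C + 1))"
  have b: "t\<^sub>0 < b" "b \<le> 1" using t0 \<eta> C by (auto simp: b_def)
  have u_large: "\<eta> \<le> \<bar>u t\<bar>" if "t \<in> {t\<^sub>0..b}" for t
  proof -
    have "\<bar>u t - u t\<^sub>0\<bar> \<le> C * (t - t\<^sub>0)"
      using lipschitz_onD[OF lip, of t t\<^sub>0] that b t0 by (simp add: dist_real_def)
    also have "\<dots> \<le> (C + 1) * (\<eta> / (C + 1))"
      using C that by (intro mult_mono) (auto simp: b_def)
    also have "\<dots> = \<eta>" using C by simp
    finally show ?thesis unfolding \<eta>_def by (simp add: abs_real_def split: if_splits)
  qed
  obtain q c where q: "t\<^sub>0 < q" "q < b" and c: "0 < c"
    and \<rho>: "AE t in lborel. t \<in> {q<..<q + 1} \<longrightarrow> c * (t - q) powr (-3/4) \<le> \<rho> t"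
    using rough[OF b(1)] by blast
  obtain f where f: "AE t in lborel. t \<in> {0<..<1} \<longrightarrow> (u has_real_derivative f t) (at t) \<and> \<bar>f t\<bar> \<le> C"
    using lipschitz_on_unit_interval_density[OF lip] by metis
  \<comment> \<open>The second term solves \<open>c * d powr (-3/4) = 2 * C + 1\<close>: closer to \<open>q\<close> than this, \<open>\<rho>\<close> exceeds
      \<open>2 * C\<close>.\<close>
  define d where "d = min (b - q) ((c / (2 * C + 1)) powr (4/3))"
  have d: "0 < d" "q + d \<le> b" using q c C by (auto simp: d_def)
  have dominates: "2 * C \<le> c * s powr (-3/4)" if "0 < s" "s < d" for s
  proof -
    have "s powr (3/4) \<le> ((c / (2 * C + 1)) powr (4/3)) powr (3/4)"
      using that by (intro powr_mono2) (auto simp: d_def)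
    also have "\<dots> = c / (2 * C + 1)" using c C by (simp add: powr_powr)
    finally have "(2 * C + 1) * s powr (3/4) \<le> c" using C by (simp add: field_simps)
    then have "2 * C + 1 \<le> c / s powr (3/4)" using that by (simp add: field_simps)
    then show ?thesis using powr_minus_divide[of s "3/4"] by simp
  qed
  show ?thesis
    unfolding energy_def
  proof (rule nn_integral_inverse_powr_infinite[where q = q and d = d and c = "\<eta>\<^sup>2 * (c\<^sup>2 / 4)"])
    show "0 < \<eta>\<^sup>2 * (c\<^sup>2 / 4)" using \<eta> c by simp
    show "AE t in lborel. t \<in> {q<..<q + d} \<longrightarrow>
      ennreal (\<eta>\<^sup>2 * (c\<^sup>2 / 4) * (t - q) powr (-3/2)) \<le>
      ennreal (contact_lagrangian v t (v t + u t) (deriv (\<lambda>t. v t + u t) t)) * indicator {0..1} t"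
      using v_deriv \<rho> f
    proof eventually_elim
      case (elim t)
      show ?case
      proof
        assume t: "t \<in> {q<..<q + d}"
        have t': "t \<in> {0<..<1}" "t \<in> {t\<^sub>0..b}" "t \<in> {q<..<q + 1}" using t d q t0 b by auto
        define x where "x = (t - q) powr (-3/4)"
        have "((\<lambda>t. v t + u t) has_real_derivative \<rho> t + f t) (at t)"
          using elim t' by (intro DERIV_add) auto
        then have D: "deriv (\<lambda>t. v t + u t) t = \<rho> t + f t" by (rule DERIV_imp_deriv)
        have "c * x / 2 \<le> \<rho> t + f t"
          using elim t' dominates[of "t - q"] t by (auto simp: x_def)
        moreover have "0 \<le> c * x / 2" using c by (simp add: x_def)
        ultimately have "(c * x / 2)\<^sup>2 \<le> (\<rho> t + f t)\<^sup>2" by (rule power_mono)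
        moreover have "\<eta>\<^sup>2 \<le> (u t)\<^sup>2"
          using u_large[OF t'(2)] \<eta> by (metis abs_le_square_iff abs_of_pos)
        ultimately have "\<eta>\<^sup>2 * (c * x / 2)\<^sup>2 \<le> (u t)\<^sup>2 * (\<rho> t + f t)\<^sup>2"
          by (intro mult_mono) auto
        moreover have "x\<^sup>2 = (t - q) powr (-3/2)"
          unfolding x_def power2_eq_square by (simp flip: powr_add)
        ultimately have "\<eta>\<^sup>2 * (c\<^sup>2 / 4) * (t - q) powr (-3/2) \<le> (u t)\<^sup>2 * (\<rho> t + f t)\<^sup>2"
          by (simp add: power_mult_distrib power_divide)
        then show "ennreal (\<eta>\<^sup>2 * (c\<^sup>2 / 4) * (t - q) powr (-3/2)) \<le>
          ennreal (contact_lagrangian v t (v t + u t) (deriv (\<lambda>t. v t + u t) t)) * indicator {0..1} t"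
          using t' by (simp add: contact_lagrangian_def D)
      qed
    qed
  qed (rule d(1))
qed

section \<open>Lipschitz competitors have energy bounded below\<close>

text \<open>
  A Lipschitz function starts at \<open>0\<close> at a finite slope, hence strictly below \<open>v / 2\<close>, because \<open>v\<close>
  rises at least like \<open>t powr (1/4)\<close>. As it ends above \<open>v / 2\<close>, there is a first positive time \<open>b\<close> at
  which it has caught up.
\<close>

lemma first_crossing:
  fixes v w :: "real \<Rightarrow> real"
  assumes cont: "continuous_on {0..1} v"
    and v: "\<And>t. t \<in> {0..1} \<Longrightarrow> t powr (1/4) \<le> v t"
    and lip: "C-lipschitz_on {0..1} w" and w: "w 0 = 0" "w 1 = v 1"
  obtains b where "0 < b" "b \<le> 1" "v b / 2 \<le> w b" "\<And>t. t \<in> {0<..<b} \<Longrightarrow> w t < v t / 2"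
proof -
  have C: "0 \<le> C" using lip by (rule lipschitz_on_nonneg)
  \<comment> \<open>The second term solves \<open>\<tau> powr (3/4) = 1 / (2 * C + 2)\<close>; before this time \<open>C * t\<close> is less than
      half of \<open>t powr (1/4)\<close>.\<close>
  define \<tau> where "\<tau> = min 1 ((1 / (2 * C + 2)) powr (4/3))"
  have \<tau>: "0 < \<tau>" "\<tau> \<le> 1" using C by (auto simp: \<tau>_def)
  have early: "w t < v t / 2" if t: "0 < t" "t < \<tau>" for t
  proof -
    have "t powr (3/4) \<le> ((1 / (2 * C + 2)) powr (4/3)) powr (3/4)"
      using t by (intro powr_mono2) (auto simp: \<tau>_def)
    also have "\<dots> = 1 / (2 * C + 2)" using C by (simp add: powr_powr)
    finally have small: "t powr (3/4) \<le> 1 / (2 * C + 2)" .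
    have "w t \<le> C * t"
      using lipschitz_onD[OF lip, of t 0] t \<tau> w by (simp add: dist_real_def)
    also have "\<dots> = C * (t powr (3/4) * t powr (1/4))"
      using t by (simp flip: powr_add)
    also have "\<dots> \<le> C * (1 / (2 * C + 2) * t powr (1/4))"
      using C small by (intro mult_left_mono mult_right_mono) auto
    also have "\<dots> < t powr (1/4) / 2" using C t by (simp add: field_simps)
    also have "\<dots> \<le> v t / 2" using v[of t] t \<tau> by simp
    finally show ?thesis .
  qed
  define S where "S = {\<tau>..1} \<inter> (\<lambda>t. w t - v t / 2) -` {0..}"
  have "continuous_on {\<tau>..1} (\<lambda>t. w t - v t / 2)"
    using \<tau> lipschitz_on_continuous_on[OF lip] cont
    by (intro continuous_intros) (auto elim: continuous_on_subset)
  then have "closed S" unfolding S_def by (intro continuous_closed_preimage) auto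
  moreover have "bounded S" unfolding S_def by (rule bounded_subset[of "{\<tau>..1}"]) auto
  moreover have "1 \<in> S" using w v[of 1] \<tau> by (simp add: S_def)
  ultimately obtain b where b: "b \<in> S" "\<And>t. t \<in> S \<Longrightarrow> b \<le> t"
    using compact_attains_inf[of S] by (auto simp: compact_eq_bounded_closed)
  show ?thesis
  proof
    show "w t < v t / 2" if t: "t \<in> {0<..<b}" for t
    proof (cases "t < \<tau>")
      case True
      then show ?thesis using early t by simp
    next
      case False
      have "t \<notin> S" using b(2)[of t] t by auto
      with False t b(1) show ?thesis by (auto simp: S_def)
    qed
  qed (use b(1) \<tau> in \<open>auto simp: S_def\<close>)
qed

text \<open>
  Mania's argument. Before the crossing time \<open>b\<close> one has \<open>v - w \<ge> v / 2 \<ge> t powr (1/4) / 2\<close>, so the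
  integrand is at least \<open>t powr (1/2) * w'\<^sup>2 / 4\<close>. For every constant \<open>\<sigma>\<close> this is at least
  \<open>(2 * \<sigma> * w' - \<sigma>\<^sup>2 * t powr (-1/2)) / 4\<close>, an expression that is linear in \<open>w'\<close> with constant
  coefficient and can therefore be integrated using only \<open>w b \<ge> b powr (1/4) / 2\<close>. Taking \<open>\<sigma>\<close>
  inversely proportional to \<open>b powr (1/4)\<close> makes the result independent of \<open>b\<close>, and thereby of
  the Lipschitz constant of \<open>w\<close>.
\<close>

lemma energy_lower_bound:
  fixes v w :: "real \<Rightarrow> real"
  assumes cont: "continuous_on {0..1} v"
    and v: "\<And>t. t \<in> {0..1} \<Longrightarrow> t powr (1/4) \<le> v t"
    and w: "w \<in> W1inf" "w 0 = 0" "w 1 = v 1"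
  shows "ennreal (1/32) \<le> energy (contact_lagrangian v) w"
proof -
  obtain C where lip: "C-lipschitz_on {0..1} w" using w by (auto simp: W1inf_def)
  obtain b where b: "0 < b" "b \<le> 1" "v b / 2 \<le> w b"
    and below: "\<And>t. t \<in> {0<..<b} \<Longrightarrow> w t < v t / 2"
    using first_crossing[OF cont v lip w(2,3)] by metis
  obtain f where f: "set_integrable lborel {0..b} f" "(LINT t:{0..b}|lborel. f t) = w b"
    and f_deriv: "AE t in lborel. t \<in> {0<..<1} \<longrightarrow> (w has_real_derivative f t) (at t)"
    using lipschitz_on_unit_interval_density[OF lip] b w(2) by (smt (verit) atLeastAtMost_iff eventually_mono)
  define \<beta> where "\<beta> = b powr (1/4)"
  have \<beta>: "0 < \<beta>" "\<beta>\<^sup>2 = b powr (1/2)" "\<beta> / 2 \<le> w b"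
    using b v[of b] by (auto simp: \<beta>_def power2_eq_square simp flip: powr_add)
  \<comment> \<open>With \<open>w b\<close> replaced by its lower bound \<open>\<beta> / 2\<close>, the integral of \<open>h\<close> is
      \<open>\<sigma> * \<beta> - 2 * (\<sigma> * \<beta>)\<^sup>2\<close>, which is largest at \<open>\<sigma> * \<beta> = 1/4\<close>.\<close>
  define \<sigma> where "\<sigma> = 1 / (4 * \<beta>)"
  define h where "h t = (2 * \<sigma>) * (indicator {0..b} t * f t) - \<sigma>\<^sup>2 * (indicator {0..b} t * t powr (-1/2))" for t
  have hb: "has_bochner_integral lborel (\<lambda>t. indicator {0..b} t * t powr (-1/2)) (2 * \<beta>\<^sup>2)"
    using has_bochner_integral_powr_from_0[of "-1/2" b] b \<beta>(2)
    by (simp add: mult.commute[of 2])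
  have hf: "has_bochner_integral lborel (\<lambda>t. indicator {0..b} t * f t) (w b)"
    using f by (simp add: has_bochner_integral_iff set_integrable_def set_lebesgue_integral_def)
  have h: "has_bochner_integral lborel h (2 * \<sigma> * w b - \<sigma>\<^sup>2 * (2 * \<beta>\<^sup>2))"
    unfolding h_def
    by (intro has_bochner_integral_diff has_bochner_integral_mult_right hb hf)
  have "2 * \<sigma> * (\<beta> / 2) \<le> 2 * \<sigma> * w b"
    using \<beta> by (intro mult_left_mono) (auto simp: \<sigma>_def)
  moreover have "2 * \<sigma> * (\<beta> / 2) = 1/4" "\<sigma>\<^sup>2 * (2 * \<beta>\<^sup>2) = 1/8"
    using \<beta>(1) by (auto simp: \<sigma>_def power2_eq_square)
  ultimately have h_int: "1/8 \<le> (LINT t|lborel. h t)"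
    using h by (simp add: has_bochner_integral_iff)
  have "integrable lborel h" using h by (simp add: has_bochner_integral_iff)
  then have int: "integrable lborel (\<lambda>t. max 0 (h t / 4))" by simp
  have "1/32 \<le> (LINT t|lborel. h t / 4)" using h_int by simp
  also have "\<dots> \<le> (LINT t|lborel. max 0 (h t / 4))"
    using \<open>integrable lborel h\<close> int by (intro integral_mono) auto
  finally have "ennreal (1/32) \<le> ennreal (LINT t|lborel. max 0 (h t / 4))" by (rule ennreal_leI)
  also have "\<dots> = (\<integral>\<^sup>+t. ennreal (max 0 (h t / 4)) \<partial>lborel)"
    using int by (intro nn_integral_eq_integral[symmetric]) auto
  also have "\<dots> \<le> energy (contact_lagrangian v) w"
    unfolding energy_def
  proof (rule nn_integral_mono_AE)
    have "AE t in lborel. t \<noteq> 0" "AE t in lborel. t \<noteq> b" by (simp_all add: AE_lborel_singleton)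
    with f_deriv
    show "AE t in lborel. ennreal (max 0 (h t / 4)) \<le>
      ennreal (contact_lagrangian v t (w t) (deriv w t)) * indicator {0..1} t"
    proof eventually_elim
      case (elim t)
      show ?case
      proof (cases "t \<in> {0<..<b}")
        case False
        with elim have "t \<notin> {0..b}" by auto
        then show ?thesis by (simp add: h_def)
      next
        case True
        with b have t: "t \<in> {0<..<1}" by auto
        have D: "deriv w t = f t" using elim t by (intro DERIV_imp_deriv) auto
        define x where "x = t powr (1/4)"
        have x2: "x\<^sup>2 = t powr (1/2)" by (simp add: x_def power2_eq_square flip: powr_add)
        have x: "0 < x" "t powr (- (1/2)) = 1 / x\<^sup>2" "x \<le> v t"
          using t v[of t] powr_minus_divide[of t "1/2"] by (simp_all add: x_def x2[unfolded x_def])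
        have h_eq: "h t = 2 * \<sigma> * f t - \<sigma>\<^sup>2 / x\<^sup>2"
          using True by (simp add: h_def x(2))
        \<comment> \<open>Completing the square is what trades \<open>(f t)\<^sup>2\<close> for a term linear in \<open>f t\<close>.\<close>
        have "0 \<le> (x * f t - \<sigma> / x)\<^sup>2" by simp
        also have "(x * f t - \<sigma> / x)\<^sup>2 = x\<^sup>2 * (f t)\<^sup>2 - h t"
          using x(1) unfolding h_eq by (simp add: power2_eq_square field_simps)
        finally have "h t / 4 \<le> (x / 2)\<^sup>2 * (f t)\<^sup>2" by (simp add: power_divide)
        also have "(x / 2)\<^sup>2 * (f t)\<^sup>2 \<le> (w t - v t)\<^sup>2 * (f t)\<^sup>2"
        proof (rule mult_right_mono)
          have "x / 2 \<le> v t - w t" using below[OF True] x by simp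
          then have "(x / 2)\<^sup>2 \<le> (v t - w t)\<^sup>2" using x by (intro power_mono) auto
          then show "(x / 2)\<^sup>2 \<le> (w t - v t)\<^sup>2" by (simp add: power2_commute)
        qed simp
        finally have "max 0 (h t / 4) \<le> (w t - v t)\<^sup>2 * (f t)\<^sup>2" by simp
        then show ?thesis using t by (simp add: contact_lagrangian_def D ennreal_leI)
      qed
    qed
  qed
  finally show ?thesis .
qed

section \<open>The theorem\<close>

theorem theorem19:
  shows "\<exists>(v :: real \<Rightarrow> real) (L :: real \<Rightarrow> real \<Rightarrow> real \<Rightarrow> real).
    v \<in> W11 \<and> lagrangian L \<and>
    is_minimizer L (v 0) (v 1) v \<and>
    0 \<le> energy L v \<and> energy L v < \<infinity> \<and>
    (\<forall>u\<in>W1inf0. (\<exists>t\<in>{0..1}. u t \<noteq> 0) \<longrightarrow> energy L (\<lambda>t. v t + u t) = \<infinity>) \<and>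
    lavrentiev L v"
proof -
  obtain v \<rho> :: "real \<Rightarrow> real" where ac: "\<And>S. abs_continuous_on S v" and v0: "v 0 = 0"
    and v_ge: "\<And>t. t \<in> {0..1} \<Longrightarrow> t powr (1/4) \<le> v t"
    and v_deriv: "AE t in lborel. (v has_real_derivative \<rho> t) (at t)"
    and rough: "\<And>a b. a < b \<Longrightarrow> \<exists>q c. a < q \<and> q < b \<and> 0 < c \<and>
       (AE t in lborel. t \<in> {q<..<q + 1} \<longrightarrow> c * (t - q) powr (-3/4) \<le> \<rho> t)"
    using function_with_nowhere_square_integrable_derivative by blast
  let ?L = "contact_lagrangian v"
  have cont: "continuous_on {0..1} v" using ac by (rule abs_continuous_on_imp_continuous_on)
  have v_W11: "v \<in> W11" using ac by (simp add: W11_def)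
  have "is_minimizer ?L (v 0) (v 1) v"
    using v_W11 by (simp add: is_minimizer_def admissible_def energy_contact_lagrangian_self)
  moreover have "energy ?L (\<lambda>t. v t + u t) = \<infinity>"
    if "u \<in> W1inf0" "\<exists>t\<in>{0..1}. u t \<noteq> 0" for u
    using energy_infinite_of_lipschitz_perturbation[OF v_deriv rough] that by blast
  moreover have "lavrentiev ?L v"
    unfolding lavrentiev_def energy_contact_lagrangian_self
  proof (intro notI, elim exE conjE)
    fix w :: "nat \<Rightarrow> real \<Rightarrow> real"
    assume w: "\<forall>j. w j \<in> W1inf \<inter> admissible (v 0) (v 1)"
      and lim: "(\<lambda>j. energy ?L (w j)) \<longlonglongrightarrow> 0"
    have "ennreal (1/32) \<le> energy ?L (w j)" for j
      using w v0 by (intro energy_lower_bound cont v_ge) (auto simp: admissible_def)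
    then have "ennreal (1/32) \<le> 0"
      by (intro LIMSEQ_le_const[OF lim]) auto
    then show False by simp
  qed
  ultimately show ?thesis
    using v_W11 lagrangian_contact_lagrangian[OF cont] energy_contact_lagrangian_self[of v]
    by (intro exI[of _ v] exI[of _ ?L]) auto
qed

end
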